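(* Let $d \ge 1$, let $\mathcal{X}_1, \dots, \mathcal{X}_d$ be finite nonempty subsets of $\mathbb{R}$, and for each $j = 1,\dots,d$ let $\mathcal{F}_j$ be an arbitrary class of real-valued functions on $\mathcal{X}_j$. Let $\mu^* \in \mathbb{R}$ and let $f_j^* \in \mathcal{F}_j$ satisfy $\sum_{i_j \in \mathcal{X}_j} f_j^*(i_j) = 0$ for $j=1,\dots,d$. Consider observations $$y_{i_1,\dots,i_d} = \mu^* + f_1^*(i_1) + \dots + f_d^*(i_d) + \varepsilon_{i_1,\dots,i_d}, \qquad i_j \in \mathcal{X}_j,\ j=1,\dots,d,$$ where the $\varepsilon_{i_1,\dots,i_d}$ are unobserved errors. Let $\hat f_1,\dots,\hat f_d$ denote the least squares estimators of $f_1^*,\dots,f_d^*$, and let $\hat f_1^{OR},\dots,\hat f_d^{OR}$ denote the corresponding oracle estimators (both defined in the context). Then $\hat f_j = \hat f_j^{OR}$ for every $j = 1,\dots,d$.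
   Context: The least squares estimators $(\hat\mu,\hat f_1,\dots,\hat f_d)$ are defined as a minimizer (assumed to exist) of $$\sum_{i_1 \in \mathcal{X}_1} \cdots \sum_{i_d \in \mathcal{X}_d} \Big(y_{i_1,\dots,i_d} - \mu - \sum_{j=1}^d f_j(i_j)\Big)^2$$ over $\mu \in \mathbb{R}$ and $f_j \in \mathcal{F}_j$ with $\sum_{i_j \in \mathcal{X}_j} f_j(i_j) = 0$, $j=1,\dots,d$. For each $k = 1,\dots,d$, the oracle estimator $\hat f_k^{OR}$ is defined as a minimizer of $$\sum_{i_1 \in \mathcal{X}_1} \cdots \sum_{i_d \in \mathcal{X}_d} \Big(y_{i_1,\dots,i_d} - \mu^* - \sum_{j \ne k} f_j^*(i_j) - f_k(i_k)\Big)^2$$ over $f_k \in \mathcal{F}_k$ with $\sum_{i_k \in \mathcal{X}_k} f_k(i_k) = 0$ (so it uses the true $\mu^*$ and $f_j^*$, $j \neq k$). Functions are considered only through their values at the design points. When minimizers are not unique, the equality $\hat f_j = \hat f_j^{OR}$ is understood as equality of the argmin sets: the set of functions that occur as the $j$-th function component of a minimizer of the first problem equals the set of minimizers of the $j$-th oracle problem. *)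

theory Defs
  imports Complex_Main "HOL-Library.FuncSet"
begin

text \<open>A real function on a finite set \<open>A\<close> of reals is an element of \<open>A \<rightarrow>\<^sub>E UNIV\<close>, so that it is
  determined by its values on \<open>A\<close>. A design point \<open>(i\<^sub>1, \<dots>, i\<^sub>d)\<close> is an element \<open>i\<close> of
  \<open>Pi\<^sub>E {1..d} X\<close>, and \<open>y i\<close> is the observation there.\<close>

definition centered :: "real set \<Rightarrow> (real \<Rightarrow> real) set \<Rightarrow> (real \<Rightarrow> real) set" where
  "centered A G = {g \<in> G. (\<Sum>x\<in>A. g x) = 0}"

definition ls_loss ::
  "nat \<Rightarrow> (nat \<Rightarrow> real set) \<Rightarrow> ((nat \<Rightarrow> real) \<Rightarrow> real) \<Rightarrow> real \<Rightarrow> (nat \<Rightarrow> real \<Rightarrow> real) \<Rightarrow> real" where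
  "ls_loss d X y \<mu> f = (\<Sum>i\<in>Pi\<^sub>E {1..d} X. (y i - \<mu> - (\<Sum>j=1..d. f j (i j)))\<^sup>2)"

definition ls_estimators ::
  "nat \<Rightarrow> (nat \<Rightarrow> real set) \<Rightarrow> (nat \<Rightarrow> (real \<Rightarrow> real) set) \<Rightarrow> ((nat \<Rightarrow> real) \<Rightarrow> real)
    \<Rightarrow> (real \<times> (nat \<Rightarrow> real \<Rightarrow> real)) set" where
  "ls_estimators d X F y =
    {p. is_arg_min (\<lambda>(\<mu>, f). ls_loss d X y \<mu> f)
          (\<lambda>(\<mu>, f). f \<in> Pi\<^sub>E {1..d} (\<lambda>j. centered (X j) (F j))) p}"

definition oracle_loss ::
  "nat \<Rightarrow> (nat \<Rightarrow> real set) \<Rightarrow> ((nat \<Rightarrow> real) \<Rightarrow> real) \<Rightarrow> real \<Rightarrow> (nat \<Rightarrow> real \<Rightarrow> real)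
    \<Rightarrow> nat \<Rightarrow> (real \<Rightarrow> real) \<Rightarrow> real" where
  "oracle_loss d X y \<mu>s fs k g =
    (\<Sum>i\<in>Pi\<^sub>E {1..d} X. (y i - \<mu>s - (\<Sum>j\<in>{1..d} - {k}. fs j (i j)) - g (i k))\<^sup>2)"

definition oracle_estimators ::
  "nat \<Rightarrow> (nat \<Rightarrow> real set) \<Rightarrow> (nat \<Rightarrow> (real \<Rightarrow> real) set) \<Rightarrow> ((nat \<Rightarrow> real) \<Rightarrow> real)
    \<Rightarrow> real \<Rightarrow> (nat \<Rightarrow> real \<Rightarrow> real) \<Rightarrow> nat \<Rightarrow> (real \<Rightarrow> real) set" where
  "oracle_estimators d X F y \<mu>s fs k =
    {g. is_arg_min (oracle_loss d X y \<mu>s fs k) (\<lambda>g. g \<in> centered (X k) (F k)) g}"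

end

theory Submission
  imports Defs
begin

text \<open>A centered function of the coordinate \<open>j\<close> has zero sum over the product design against every
  product of functions of the other coordinates. Expanding the square therefore leaves no cross
  terms: on centered components the least squares loss is a function of \<open>\<mu>\<close> plus one
  term for each component. The oracle loss is the same loss at \<open>\<mu>s\<close> and \<open>fs\<close> with the
  \<open>k\<close>th component free, so both problems minimize the same functional of that component.\<close>

text \<open>Over a product set, a sum of products factors into a product of one-dimensional sums,
  and the factor at \<open>j\<close> vanishes.\<close>

lemma sum_PiE_prod_eq_0:
  fixes w :: "'i \<Rightarrow> 'a \<Rightarrow> real"
  assumes "finite I" "\<And>j. j \<in> I \<Longrightarrow> finite (X j)" "j \<in> I" "(\<Sum>x\<in>X j. w j x) = 0"
  shows "(\<Sum>i\<in>Pi\<^sub>E I X. \<Prod>l\<in>I. w l (i l)) = 0"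
proof -
  have "(\<Sum>i\<in>Pi\<^sub>E I X. \<Prod>l\<in>I. w l (i l)) = (\<Prod>l\<in>I. \<Sum>x\<in>X l. w l x)"
    using assms(1,2) by (rule prod_sum_PiE[symmetric])
  also have "\<dots> = 0"
    using assms by (intro prod_zero) auto
  finally show ?thesis .
qed

lemma sum_PiE_coord_eq_0:
  fixes u :: "'a \<Rightarrow> real"
  assumes "finite I" "\<And>j. j \<in> I \<Longrightarrow> finite (X j)" "j \<in> I" "(\<Sum>x\<in>X j. u x) = 0"
  shows "(\<Sum>i\<in>Pi\<^sub>E I X. u (i j)) = 0"
proof -
  have "(\<Prod>l\<in>I. (if l = j then u else (\<lambda>_. 1)) (i l)) = u (i j)" for i
    using assms(1,3) by (subst prod.remove[of _ j]) auto
  then show ?thesis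
    using sum_PiE_prod_eq_0[of I X j "\<lambda>l. if l = j then u else (\<lambda>_. 1)"] assms by simp
qed

text \<open>Orthogonality of distinct coordinates: the product weight is \<open>u\<close> at
  \<open>j\<close>, \<open>v\<close> at \<open>k\<close> and 1 elsewhere, so the factor at
  \<open>j\<close> kills the sum.\<close>

lemma sum_PiE_coord_mult_eq_0:
  fixes u v :: "'a \<Rightarrow> real"
  assumes "finite I" "\<And>j. j \<in> I \<Longrightarrow> finite (X j)" "j \<in> I" "k \<in> I" "j \<noteq> k"
    and "(\<Sum>x\<in>X j. u x) = 0"
  shows "(\<Sum>i\<in>Pi\<^sub>E I X. u (i j) * v (i k)) = 0"
proof -
  let ?w = "\<lambda>l. if l = j then u else if l = k then v else (\<lambda>_. 1)"
  have "(\<Prod>l\<in>I. ?w l (i l)) = u (i j) * v (i k)" for i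
    using assms(1,3-5) by (subst prod.remove[of _ j], simp, simp, subst prod.remove[of _ k]) auto
  then show ?thesis
    using sum_PiE_prod_eq_0[of I X j ?w] assms by simp
qed

text \<open>Up to the constant sum of \<open>(y i)\<^sup>2\<close>, this is the squared distance
  between \<open>y\<close> and \<open>g\<close> read as a function of coordinate \<open>j\<close>.
  Neither \<mu> nor any other component enters, which is what makes the two estimation problems
  comparable.\<close>

definition component_loss ::
  "nat \<Rightarrow> (nat \<Rightarrow> real set) \<Rightarrow> ((nat \<Rightarrow> real) \<Rightarrow> real) \<Rightarrow> nat \<Rightarrow> (real \<Rightarrow> real) \<Rightarrow> real" where
  "component_loss d X y j g = (\<Sum>i\<in>Pi\<^sub>E {1..d} X. (g (i j))\<^sup>2 - 2 * y i * g (i j))"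

text \<open>The square of the sum of components keeps only its diagonal terms, by orthogonality of
  distinct coordinates. The mixed term loses \<mu>, since each component sums to zero over the whole
  design.\<close>

lemma ls_loss_separable:
  assumes fin: "\<And>j. j \<in> {1..d} \<Longrightarrow> finite (X j)"
    and sum0: "\<And>j. j \<in> {1..d} \<Longrightarrow> (\<Sum>x\<in>X j. f j x) = 0"
  shows "ls_loss d X y \<mu> f
    = (\<Sum>i\<in>Pi\<^sub>E {1..d} X. (y i - \<mu>)\<^sup>2) + (\<Sum>j=1..d. component_loss d X y j (f j))"
proof -
  let ?S = "Pi\<^sub>E {1..d} X"
  have coord: "(\<Sum>i\<in>?S. f j (i j)) = 0" if "j \<in> {1..d}" for j
    using fin that sum0 by (intro sum_PiE_coord_eq_0) auto
  have cross: "(\<Sum>i\<in>?S. f j (i j) * f k (i k)) = (if j = k then \<Sum>i\<in>?S. (f j (i j))\<^sup>2 else 0)"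
    if "j \<in> {1..d}" "k \<in> {1..d}" for j k
    using fin that sum0 sum_PiE_coord_mult_eq_0[of "{1..d}" X j k "f j" "f k"]
    by (auto simp: power2_eq_square)
  have linear: "(\<Sum>i\<in>?S. (y i - \<mu>) * f j (i j)) = (\<Sum>i\<in>?S. y i * f j (i j))"
    if "j \<in> {1..d}" for j
    using coord[OF that] by (simp add: left_diff_distrib sum_subtractf flip: sum_distrib_left)
  have "(\<Sum>i\<in>?S. (\<Sum>j=1..d. f j (i j))\<^sup>2) = (\<Sum>i\<in>?S. \<Sum>j=1..d. \<Sum>k=1..d. f j (i j) * f k (i k))"
    by (simp add: power2_eq_square sum_product)
  also have "\<dots> = (\<Sum>j=1..d. \<Sum>i\<in>?S. \<Sum>k=1..d. f j (i j) * f k (i k))"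
    by (rule sum.swap)
  also have "\<dots> = (\<Sum>j=1..d. \<Sum>k=1..d. \<Sum>i\<in>?S. f j (i j) * f k (i k))"
    by (intro sum.cong refl sum.swap)
  also have "\<dots> = (\<Sum>j=1..d. \<Sum>k=1..d. if j = k then \<Sum>i\<in>?S. (f j (i j))\<^sup>2 else 0)"
    using cross by (intro sum.cong refl) auto
  also have "\<dots> = (\<Sum>j=1..d. \<Sum>i\<in>?S. (f j (i j))\<^sup>2)"
    by (intro sum.cong refl) simp
  finally have square: "(\<Sum>i\<in>?S. (\<Sum>j=1..d. f j (i j))\<^sup>2) = (\<Sum>j=1..d. \<Sum>i\<in>?S. (f j (i j))\<^sup>2)" .
  have "(\<Sum>i\<in>?S. (y i - \<mu>) * (\<Sum>j=1..d. f j (i j)))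
    = (\<Sum>j=1..d. \<Sum>i\<in>?S. (y i - \<mu>) * f j (i j))"
    by (subst sum.swap) (simp add: sum_distrib_left)
  also have "\<dots> = (\<Sum>j=1..d. \<Sum>i\<in>?S. y i * f j (i j))"
    by (intro sum.cong refl linear)
  finally have mixed: "(\<Sum>i\<in>?S. (y i - \<mu>) * (\<Sum>j=1..d. f j (i j)))
    = (\<Sum>j=1..d. \<Sum>i\<in>?S. y i * f j (i j))" .
  have "ls_loss d X y \<mu> f = (\<Sum>i\<in>?S. (y i - \<mu>)\<^sup>2)
    + ((\<Sum>i\<in>?S. (\<Sum>j=1..d. f j (i j))\<^sup>2) - 2 * (\<Sum>i\<in>?S. (y i - \<mu>) * (\<Sum>j=1..d. f j (i j))))"
    \<comment> \<open>All sums over the design are merged into one, so that the claim becomes the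
      pointwise square of a difference, with \<open>y i - \<mu>\<close> as the first term.\<close>
    unfolding ls_loss_def sum_distrib_left[of 2 _ ?S] sum_subtractf[symmetric] sum.distrib[symmetric]
    by (intro sum.cong refl) (simp add: power2_diff[of "y _ - \<mu>"])
  also have "(\<Sum>i\<in>?S. (\<Sum>j=1..d. f j (i j))\<^sup>2)
      - 2 * (\<Sum>i\<in>?S. (y i - \<mu>) * (\<Sum>j=1..d. f j (i j)))
    = (\<Sum>j=1..d. component_loss d X y j (f j))"
    unfolding square mixed component_loss_def
    by (simp add: sum_subtractf sum_distrib_left mult.assoc)
  finally show ?thesis .
qed

lemma oracle_loss_eq_ls_loss:
  assumes "k \<in> {1..d}"
  shows "oracle_loss d X y \<mu> f k g = ls_loss d X y \<mu> (f(k := g))"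
proof -
  have "(\<Sum>j=1..d. (f(k := g)) j (i j)) = (\<Sum>j\<in>{1..d} - {k}. f j (i j)) + g (i k)" for i
    using assms by (subst sum.remove[of _ k]) auto
  then show ?thesis
    unfolding oracle_loss_def ls_loss_def by (simp add: algebra_simps)
qed

text \<open>By separability only the \<open>k\<close>th summand changes. The change depends on
  neither \<mu> nor the other components, so exchanging one component has the same effect in both
  problems.\<close>

lemma ls_loss_update:
  assumes fin: "\<And>j. j \<in> {1..d} \<Longrightarrow> finite (X j)"
    and sum0: "\<And>j. j \<in> {1..d} \<Longrightarrow> (\<Sum>x\<in>X j. f j x) = 0"
    and k: "k \<in> {1..d}" and g: "(\<Sum>x\<in>X k. g x) = 0"
  shows "ls_loss d X y \<mu> (f(k := g))
    = ls_loss d X y \<mu> f - component_loss d X y k (f k) + component_loss d X y k g"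
proof -
  have "ls_loss d X y \<mu> (f(k := g)) = (\<Sum>i\<in>Pi\<^sub>E {1..d} X. (y i - \<mu>)\<^sup>2)
    + (\<Sum>j=1..d. component_loss d X y j ((f(k := g)) j))"
    using fin sum0 g by (intro ls_loss_separable) auto
  moreover have "ls_loss d X y \<mu> f = (\<Sum>i\<in>Pi\<^sub>E {1..d} X. (y i - \<mu>)\<^sup>2)
    + (\<Sum>j=1..d. component_loss d X y j (f j))"
    using fin sum0 by (rule ls_loss_separable)
  moreover have "(\<Sum>j=1..d. component_loss d X y j (h j))
    = component_loss d X y k (h k) + (\<Sum>j\<in>{1..d} - {k}. component_loss d X y j (h j))" for h
    using k by (intro sum.remove) auto
  ultimately show ?thesis
    by simp
qed

text \<open>On centered functions the oracle loss differs from the component loss by a constant in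
  \<open>g\<close>, so the set of minimizers does not depend on the true values
  \<open>\<mu>s\<close> and \<open>fs\<close>.\<close>

lemma oracle_estimators_eq:
  assumes "\<And>j. j \<in> {1..d} \<Longrightarrow> finite (X j)"
    and "\<And>j. j \<in> {1..d} \<Longrightarrow> (\<Sum>x\<in>X j. fs j x) = 0"
    and "k \<in> {1..d}"
  shows "oracle_estimators d X F y \<mu>s fs k
    = {g. is_arg_min (component_loss d X y k) (\<lambda>g. g \<in> centered (X k) (F k)) g}"
proof -
  \<comment> \<open>Here \<open>fs k\<close> is only a reference point: its contribution to the
    first term is removed by the second.\<close>
  have "oracle_loss d X y \<mu>s fs k g
      = ls_loss d X y \<mu>s fs - component_loss d X y k (fs k) + component_loss d X y k g"
    if "g \<in> centered (X k) (F k)" for g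
    using that assms unfolding oracle_loss_eq_ls_loss[OF assms(3)]
    by (intro ls_loss_update) (auto simp: centered_def)
  then show ?thesis
    unfolding oracle_estimators_def is_arg_min_def by auto
qed

theorem lemma3p1:
  fixes d :: nat
    and X :: "nat \<Rightarrow> real set"
    and F :: "nat \<Rightarrow> (real \<Rightarrow> real) set"
    and \<mu>s :: real
    and fs :: "nat \<Rightarrow> real \<Rightarrow> real"
    and y \<epsilon> :: "(nat \<Rightarrow> real) \<Rightarrow> real"
  assumes "d \<ge> 1"
    and "\<And>j. j \<in> {1..d} \<Longrightarrow> finite (X j) \<and> X j \<noteq> {}"
    and "\<And>j. j \<in> {1..d} \<Longrightarrow> F j \<subseteq> X j \<rightarrow>\<^sub>E UNIV"
    and "\<And>j. j \<in> {1..d} \<Longrightarrow> fs j \<in> F j"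
    and "\<And>j. j \<in> {1..d} \<Longrightarrow> (\<Sum>x\<in>X j. fs j x) = 0"
    and "\<And>i. i \<in> Pi\<^sub>E {1..d} X \<Longrightarrow> y i = \<mu>s + (\<Sum>j=1..d. fs j (i j)) + \<epsilon> i"
    and "ls_estimators d X F y \<noteq> {}"
  shows "\<forall>j\<in>{1..d}. {f j | \<mu> f. (\<mu>, f) \<in> ls_estimators d X F y} = oracle_estimators d X F y \<mu>s fs j"
proof
  fix k assume k: "k \<in> {1..d}"
  let ?C = "\<lambda>j. centered (X j) (F j)"
  let ?Q = "component_loss d X y k"
  have fin: "finite (X j)" if "j \<in> {1..d}" for j
    using assms(2) that by blast
  have oracle_iff: "g \<in> oracle_estimators d X F y \<mu>s fs k \<longleftrightarrow> g \<in> ?C k \<and> (\<forall>h\<in>?C k. ?Q g \<le> ?Q h)" for g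
    using oracle_estimators_eq[OF fin assms(5) k] by (auto simp: is_arg_min_linorder)
  have ls_iff: "(\<mu>, f) \<in> ls_estimators d X F y \<longleftrightarrow> f \<in> Pi\<^sub>E {1..d} ?C
      \<and> (\<forall>\<nu>. \<forall>h\<in>Pi\<^sub>E {1..d} ?C. ls_loss d X y \<mu> f \<le> ls_loss d X y \<nu> h)" for \<mu> f
    unfolding ls_estimators_def by (auto simp: is_arg_min_linorder)
  have update: "ls_loss d X y \<mu> (f(k := g)) = ls_loss d X y \<mu> f - ?Q (f k) + ?Q g"
    if "f \<in> Pi\<^sub>E {1..d} ?C" "g \<in> ?C k" for \<mu> f g
    using that k fin by (intro ls_loss_update) (auto simp: centered_def PiE_iff)
  \<comment> \<open>The constraints form a product, so each component can be exchanged separately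
    without leaving the feasible set.\<close>
  have update_mem: "f(k := g) \<in> Pi\<^sub>E {1..d} ?C" if "f \<in> Pi\<^sub>E {1..d} ?C" "g \<in> ?C k" for f g
    using that k by (auto simp: PiE_iff extensional_def)
  show "{f k | \<mu> f. (\<mu>, f) \<in> ls_estimators d X F y} = oracle_estimators d X F y \<mu>s fs k"
  proof (intro subset_antisym subsetI)
    fix g assume "g \<in> {f k | \<mu> f. (\<mu>, f) \<in> ls_estimators d X F y}"
    then obtain \<mu> f where g: "g = f k" and f: "(\<mu>, f) \<in> ls_estimators d X F y"
      by blast
    \<comment> \<open>The competitor keeps \<mu> and all components but the \<open>k\<close>th, so
      comparing the full losses compares only the two values of \<open>?Q\<close>.\<close>
    have "?Q (f k) \<le> ?Q h" if "h \<in> ?C k" for h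
    proof -
      have "ls_loss d X y \<mu> f \<le> ls_loss d X y \<mu> (f(k := h))"
        using f update_mem that unfolding ls_iff by blast
      then show ?thesis
        using f that update[of f h \<mu>] unfolding ls_iff by simp
    qed
    then show "g \<in> oracle_estimators d X F y \<mu>s fs k"
      using f k unfolding oracle_iff ls_iff g by (auto simp: PiE_iff)
  next
    fix g assume g: "g \<in> oracle_estimators d X F y \<mu>s fs k"
    \<comment> \<open>Existence of a least squares minimizer supplies an intercept and the other
      components with which \<open>g\<close> is to be completed.\<close>
    obtain \<mu> f where f: "(\<mu>, f) \<in> ls_estimators d X F y"
      using assms(7) by auto
    then have mem: "f \<in> Pi\<^sub>E {1..d} ?C" and "f k \<in> ?C k"
      using k unfolding ls_iff by (auto simp: PiE_iff)
    \<comment> \<open>Since \<open>f k\<close> is feasible for the oracle problem that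
      \<open>g\<close> solves, inserting \<open>g\<close> cannot raise the loss above its minimum;
      the modified pair is again a minimizer.\<close>
    then have "ls_loss d X y \<mu> (f(k := g)) \<le> ls_loss d X y \<mu> f"
      using g update[of f g \<mu>] unfolding oracle_iff by simp
    then have "(\<mu>, f(k := g)) \<in> ls_estimators d X F y"
      using f g mem update_mem unfolding ls_iff oracle_iff by (meson order_trans)
    then show "g \<in> {f k | \<mu> f. (\<mu>, f) \<in> ls_estimators d X F y}"
      by (metis (mono_tags, lifting) fun_upd_same mem_Collect_eq)
  qed
qed

end
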